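(* Let $K$ be a (not necessarily commutative) field and $V$ a $K$-vector space of infinite dimension. Then the dual $V^\ast=\operatorname{Hom}_K(V,K)$ has dimension $$\dim_K(V^\ast)=\operatorname{Card}(K)^{\dim_K(V)}.$$ In particular, for $V$ of infinite dimension, the dual $V^\ast$ is not isomorphic to $V$, i.e. $\dim_K(V^\ast)\neq\dim_K(V)$.
   Context: A field is a non-zero ring, not necessarily commutative, in which every non-zero element is invertible (division ring). $V$ is a left $K$-vector space, and $V^\ast$ is the right $K$-vector space of left $K$-linear maps $V\to K$, with scalar action $(\varphi\lambda)(x)=\varphi(x)\lambda$. Dimensions are cardinals (the cardinality of any basis), and the right-hand side is cardinal exponentiation. *)

theory Defs
  imports Main "HOL-Library.Function_Algebras"
begin

unbundle cardinal_syntax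

text \<open>
  The library locale \<open>vector_space\<close> is restricted to commutative fields, hence the
  following one-sided notions over a \<open>division_ring\<close>.
\<close>

locale left_vector_space =
  fixes scale :: "'k::division_ring \<Rightarrow> 'v::ab_group_add \<Rightarrow> 'v"
  assumes scale_right_distrib: "scale a (x + y) = scale a x + scale a y"
    and scale_left_distrib: "scale (a + b) x = scale a x + scale b x"
    and scale_scale: "scale a (scale b x) = scale (a * b) x"
    and scale_one: "scale 1 x = x"

locale right_vector_space =
  fixes scale :: "'v::ab_group_add \<Rightarrow> 'k::division_ring \<Rightarrow> 'v"
  assumes scale_left_distrib: "scale (x + y) a = scale x a + scale y a"
    and scale_right_distrib: "scale x (a + b) = scale x a + scale x b"
    and scale_scale: "scale (scale x a) b = scale x (a * b)"
    and scale_one: "scale x 1 = x"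

text \<open>
  The next notions do not depend on the side of the scalar action. They take the action with the
  scalar as first argument; for a right vector space with action \<open>scale\<close> one passes
  \<open>\<lambda>a x. scale x a\<close>. The set \<open>V\<close> is a subspace of the ambient type.
\<close>

definition lin_span :: "('k::division_ring \<Rightarrow> 'v::ab_group_add \<Rightarrow> 'v) \<Rightarrow> 'v set \<Rightarrow> 'v set" where
  "lin_span act B = {(\<Sum>b\<in>F. act (c b) b) | F c. finite F \<and> F \<subseteq> B}"

definition lin_indep :: "('k::division_ring \<Rightarrow> 'v::ab_group_add \<Rightarrow> 'v) \<Rightarrow> 'v set \<Rightarrow> bool" where
  "lin_indep act B \<longleftrightarrow>
     (\<forall>F c. finite F \<and> F \<subseteq> B \<and> (\<Sum>b\<in>F. act (c b) b) = 0 \<longrightarrow> (\<forall>b\<in>F. c b = 0))"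

definition lin_subspace :: "('k::division_ring \<Rightarrow> 'v::ab_group_add \<Rightarrow> 'v) \<Rightarrow> 'v set \<Rightarrow> bool" where
  "lin_subspace act V \<longleftrightarrow>
     0 \<in> V \<and> (\<forall>x\<in>V. \<forall>y\<in>V. x + y \<in> V) \<and> (\<forall>a. \<forall>x\<in>V. act a x \<in> V)"

definition is_basis ::
    "('k::division_ring \<Rightarrow> 'v::ab_group_add \<Rightarrow> 'v) \<Rightarrow> 'v set \<Rightarrow> 'v set \<Rightarrow> bool" where
  "is_basis act V B \<longleftrightarrow> lin_indep act B \<and> lin_span act B = V"

text \<open>
  The dimension is a cardinal, to be compared by \<open>=o\<close>. It does not depend on the chosen basis, see
  \<open>left_vector_space.dimension_eq\<close> and \<open>right_vector_space.dimension_eq\<close> below.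
\<close>

definition dimension :: "('k::division_ring \<Rightarrow> 'v::ab_group_add \<Rightarrow> 'v) \<Rightarrow> 'v set \<Rightarrow> 'v rel" where
  "dimension act V = |SOME B. is_basis act V B|"

definition dual :: "('k::division_ring \<Rightarrow> 'v::ab_group_add \<Rightarrow> 'v) \<Rightarrow> ('v \<Rightarrow> 'k) set" where
  "dual scale =
     {\<phi>. (\<forall>x y. \<phi> (x + y) = \<phi> x + \<phi> y) \<and> (\<forall>a x. \<phi> (scale a x) = a * \<phi> x)}"

definition dual_scale :: "('v \<Rightarrow> 'k::division_ring) \<Rightarrow> 'k \<Rightarrow> ('v \<Rightarrow> 'k)" where
  "dual_scale \<phi> a = (\<lambda>x. \<phi> x * a)"

text \<open>
  Existence of bases and invariance of dimension, for left and right vector spaces at once: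
  \<open>mult\<close> is the multiplication of the division ring or its opposite.
\<close>

locale skew_action =
  fixes act :: "'k::division_ring \<Rightarrow> 'v::ab_group_add \<Rightarrow> 'v"
    and mult :: "'k \<Rightarrow> 'k \<Rightarrow> 'k"
  assumes act_add: "act a (x + y) = act a x + act a y"
    and add_act: "act (a + b) x = act a x + act b x"
    and act_act: "act a (act b x) = act (mult a b) x"
    and act_one: "act 1 x = x"
    and mult_inverse: "a \<noteq> 0 \<Longrightarrow> mult (inverse a) a = 1"
begin

lemma act_0 [simp]: "act a 0 = 0"
  using act_add[of a 0 0] by simp

lemma zero_act [simp]: "act 0 x = 0"
  using add_act[of 0 0 x] by simp

lemma act_minus: "act a (- x) = - act a x"
  by (rule minus_unique[symmetric]) (simp flip: act_add)

lemma minus_act: "act (- a) x = - act a x"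
  by (rule minus_unique[symmetric]) (simp flip: add_act)

lemma act_diff: "act a (x - y) = act a x - act a y"
  using act_add[of a x "- y"] by (simp add: act_minus)

lemma act_sum: "act a (\<Sum>i\<in>F. f i) = (\<Sum>i\<in>F. act a (f i))"
  by (induction F rule: infinite_finite_induct) (auto simp: act_add)

lemma inverse_act: "a \<noteq> 0 \<Longrightarrow> act (inverse a) (act a x) = x"
  by (simp add: act_act mult_inverse act_one)

lemma subspace_neg: "lin_subspace act S \<Longrightarrow> x \<in> S \<Longrightarrow> - x \<in> S"
  unfolding lin_subspace_def by (metis act_one minus_act)

lemma subspace_diff: "lin_subspace act S \<Longrightarrow> x \<in> S \<Longrightarrow> y \<in> S \<Longrightarrow> x - y \<in> S"
  using subspace_neg[of S y] unfolding lin_subspace_def by (metis diff_conv_add_uminus)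

lemma subspace_sum:
  assumes "lin_subspace act S" "\<And>i. i \<in> F \<Longrightarrow> f i \<in> S" shows "sum f F \<in> S"
  using assms(2) by (induction F rule: infinite_finite_induct)
    (use assms(1) in \<open>auto simp: lin_subspace_def\<close>)

lemma span_add:
  assumes "x \<in> lin_span act B" "y \<in> lin_span act B" shows "x + y \<in> lin_span act B"
proof -
  from assms(1) obtain F c where F: "finite F" "F \<subseteq> B" "x = (\<Sum>b\<in>F. act (c b) b)"
    unfolding lin_span_def by blast
  from assms(2) obtain G d where G: "finite G" "G \<subseteq> B" "y = (\<Sum>b\<in>G. act (d b) b)"
    unfolding lin_span_def by blast
  let ?c = "\<lambda>b. if b \<in> F then c b else 0" and ?d = "\<lambda>b. if b \<in> G then d b else 0"
  have "x = (\<Sum>b\<in>F \<union> G. act (?c b) b)"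
    unfolding F(3) by (rule sum.mono_neutral_cong_left) (use F G in auto)
  moreover have "y = (\<Sum>b\<in>F \<union> G. act (?d b) b)"
    unfolding G(3) by (rule sum.mono_neutral_cong_left) (use F G in auto)
  ultimately have "x + y = (\<Sum>b\<in>F \<union> G. act (?c b + ?d b) b)"
    by (simp only: add_act sum.distrib)
  moreover have "finite (F \<union> G)" "F \<union> G \<subseteq> B" using F G by auto
  ultimately show ?thesis
    unfolding lin_span_def mem_Collect_eq
    by (intro exI[of _ "F \<union> G"] exI[of _ "\<lambda>b. ?c b + ?d b"]) (rule conjI, assumption, blast)
qed

lemma span_subspace: "lin_subspace act (lin_span act B)"
proof -
  have "0 \<in> lin_span act B"
    unfolding lin_span_def by (rule CollectI, rule exI[of _ "{}"]) auto
  moreover have "act a x \<in> lin_span act B" if x: "x \<in> lin_span act B" for a x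
  proof -
    from x obtain F c where F: "finite F" "F \<subseteq> B" "x = (\<Sum>b\<in>F. act (c b) b)"
      unfolding lin_span_def by blast
    have "act a x = (\<Sum>b\<in>F. act (mult a (c b)) b)"
      by (simp add: F(3) act_sum act_act)
    with F(1,2) show ?thesis
      unfolding lin_span_def mem_Collect_eq
      by (intro exI[of _ F] exI[of _ "\<lambda>b. mult a (c b)"]) auto
  qed
  ultimately show ?thesis
    unfolding lin_subspace_def using span_add by blast
qed

lemma span_superset: "B \<subseteq> lin_span act B"
proof
  fix x assume "x \<in> B"
  then show "x \<in> lin_span act B"
    unfolding lin_span_def mem_Collect_eq
    by (intro exI[of _ "{x}"] exI[of _ "\<lambda>_. 1"]) (auto simp: act_one)
qed

lemma span_minimal:
  assumes "B \<subseteq> S" "lin_subspace act S" shows "lin_span act B \<subseteq> S"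
proof
  fix x assume "x \<in> lin_span act B"
  then obtain F c where F: "finite F" "F \<subseteq> B" "x = (\<Sum>b\<in>F. act (c b) b)"
    unfolding lin_span_def by blast
  have "act (c b) b \<in> S" if "b \<in> F" for b
    using that F(2) assms unfolding lin_subspace_def by blast
  then show "x \<in> S" unfolding F(3) by (intro subspace_sum[OF assms(2)])
qed

lemma span_mono: "A \<subseteq> B \<Longrightarrow> lin_span act A \<subseteq> lin_span act B"
  using span_minimal[OF _ span_subspace] span_superset by blast

lemma span_least: "A \<subseteq> lin_span act B \<Longrightarrow> lin_span act A \<subseteq> lin_span act B"
  by (rule span_minimal[OF _ span_subspace])

lemma span_insertD:
  assumes "x \<in> lin_span act (insert a B)" shows "\<exists>k. x - act k a \<in> lin_span act B"
proof -
  let ?S = "{x. \<exists>k. x - act k a \<in> lin_span act B}"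
  have sp: "lin_subspace act (lin_span act B)" by (rule span_subspace)
  have "lin_subspace act ?S"
    unfolding lin_subspace_def
  proof (intro conjI ballI allI)
    show "0 \<in> ?S" using sp by (auto simp: lin_subspace_def intro!: exI[of _ 0])
  next
    fix x y assume "x \<in> ?S" "y \<in> ?S"
    then obtain k l where "x - act k a \<in> lin_span act B" "y - act l a \<in> lin_span act B" by blast
    then have "(x - act k a) + (y - act l a) \<in> lin_span act B" by (rule span_add)
    then have "(x + y) - act (k + l) a \<in> lin_span act B" by (simp add: add_act algebra_simps)
    then show "x + y \<in> ?S" by blast
  next
    fix c x assume "x \<in> ?S"
    then obtain k where "x - act k a \<in> lin_span act B" by blast
    then have "act c (x - act k a) \<in> lin_span act B" using sp unfolding lin_subspace_def by blast
    then have "act c x - act (mult c k) a \<in> lin_span act B" by (simp add: act_diff act_act)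
    then show "act c x \<in> ?S" by blast
  qed
  moreover have "insert a B \<subseteq> ?S"
  proof
    fix x assume "x \<in> insert a B"
    then consider "x = a" | "x \<in> B" by blast
    then show "x \<in> ?S"
    proof cases
      case 1
      then have "x - act 1 a \<in> lin_span act B" using sp by (simp add: act_one lin_subspace_def)
      then show ?thesis by blast
    next
      case 2
      then have "x - act 0 a \<in> lin_span act B" using span_superset by auto
      then show ?thesis by blast
    qed
  qed
  ultimately show ?thesis using span_minimal assms by blast
qed

lemma exchange:
  assumes "a \<in> lin_span act (insert b B)" "a \<notin> lin_span act B"
  shows "b \<in> lin_span act (insert a B)"
proof -
  obtain k where k: "a - act k b \<in> lin_span act B" using span_insertD[OF assms(1)] by blast
  with assms(2) have "k \<noteq> 0" by auto
  have "a \<in> lin_span act (insert a B)" using span_superset by blast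
  moreover have "a - act k b \<in> lin_span act (insert a B)"
    using k span_mono[of B "insert a B"] by blast
  ultimately have "a - (a - act k b) \<in> lin_span act (insert a B)"
    by (rule subspace_diff[OF span_subspace])
  then have "act (inverse k) (act k b) \<in> lin_span act (insert a B)"
    using span_subspace[of "insert a B"] by (simp add: lin_subspace_def)
  then show ?thesis using \<open>k \<noteq> 0\<close> by (simp add: inverse_act)
qed

lemma indep_mono: "lin_indep act B \<Longrightarrow> A \<subseteq> B \<Longrightarrow> lin_indep act A"
  unfolding lin_indep_def by (meson subset_trans)

lemma indep_notin_span:
  assumes "lin_indep act B" "b \<in> B" shows "b \<notin> lin_span act (B - {b})"
proof
  assume "b \<in> lin_span act (B - {b})"
  then obtain F c where F: "finite F" "F \<subseteq> B - {b}" "b = (\<Sum>x\<in>F. act (c x) x)"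
    unfolding lin_span_def by blast
  let ?c = "c(b := - 1)"
  have "b \<notin> F" using F(2) by blast
  then have "(\<Sum>x\<in>insert b F. act (?c x) x) = - b + (\<Sum>x\<in>F. act (?c x) x)"
    using F(1) by (simp add: minus_act act_one)
  also have "(\<Sum>x\<in>F. act (?c x) x) = b"
    unfolding F(3) by (rule sum.cong) (use \<open>b \<notin> F\<close> F(3) in auto)
  finally have "(\<Sum>x\<in>insert b F. act (?c x) x) = 0" by simp
  moreover have "finite (insert b F)" "insert b F \<subseteq> B" using F assms(2) by auto
  ultimately have "?c b = 0" using assms(1) unfolding lin_indep_def by blast
  then show False by simp
qed

lemma indep_insert:
  assumes "lin_indep act B" "a \<notin> lin_span act B" shows "lin_indep act (insert a B)"
  unfolding lin_indep_def
proof (intro allI impI, elim conjE)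
  fix F c assume F: "finite F" "F \<subseteq> insert a B" "(\<Sum>b\<in>F. act (c b) b) = 0"
  let ?G = "F - {a}"
  have G: "finite ?G" "?G \<subseteq> B" using F by auto
  have Gs: "(\<Sum>b\<in>?G. act (c b) b) \<in> lin_span act B" using G unfolding lin_span_def by blast
  have ca: "c a = 0" if "a \<in> F"
  proof (rule ccontr)
    assume ca: "c a \<noteq> 0"
    have "act (c a) a = - (\<Sum>b\<in>?G. act (c b) b)"
      using F(3) sum.remove[OF F(1) that, of "\<lambda>b. act (c b) b"] by (metis eq_neg_iff_add_eq_0)
    then have "act (c a) a \<in> lin_span act B" using subspace_neg[OF span_subspace Gs] by simp
    then have "act (inverse (c a)) (act (c a) a) \<in> lin_span act B"
      using span_subspace[of B] unfolding lin_subspace_def by blast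
    with ca assms(2) show False by (simp add: inverse_act)
  qed
  have "(\<Sum>b\<in>?G. act (c b) b) = 0"
  proof (cases "a \<in> F")
    case True
    then show ?thesis using F(3) ca sum.remove[OF F(1) True, of "\<lambda>b. act (c b) b"] by simp
  next
    case False
    then show ?thesis using F(3) by simp
  qed
  then have "\<forall>b\<in>?G. c b = 0" using assms(1) G unfolding lin_indep_def by blast
  with ca show "\<forall>b\<in>F. c b = 0" by blast
qed

lemma steinitz_aux:
  assumes "finite S" "finite T" "lin_indep act S" "S \<subseteq> lin_span act T"
  shows "\<exists>U. finite U \<and> card U = card T \<and> S \<subseteq> U \<and> T \<subseteq> lin_span act U"
  using assms(1,3,4)
proof (induction S)
  case empty
  then show ?case using assms(2) span_superset by blast
next
  case (insert x S)
  have "lin_indep act S" using insert.prems(1) by (rule indep_mono) blast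
  moreover have "S \<subseteq> lin_span act T" using insert.prems(2) by blast
  ultimately obtain U where U: "finite U" "card U = card T" "S \<subseteq> U" "T \<subseteq> lin_span act U"
    using insert.IH by blast
  show ?case
  proof (cases "x \<in> U")
    case True
    with U show ?thesis by (intro exI[of _ U]) simp
  next
    case False
    have "x \<notin> lin_span act S"
      using indep_notin_span[OF insert.prems(1), of x] insert.hyps(2) by simp
    define P where "P = {W. S \<subseteq> W \<and> W \<subseteq> U \<and> x \<notin> lin_span act W}"
    have "finite P" unfolding P_def by (rule finite_subset[of _ "Pow U"]) (use U(1) in auto)
    moreover have "S \<in> P" using U(3) \<open>x \<notin> lin_span act S\<close> by (simp add: P_def)
    then have "P \<noteq> {}" by blast
    ultimately have "\<exists>W\<in>P. \<forall>X\<in>P. W \<subseteq> X \<longrightarrow> W = X" by (rule finite_has_maximal)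
    then obtain W where WP: "W \<in> P" and Wmax: "\<forall>X\<in>P. W \<subseteq> X \<longrightarrow> W = X" ..
    from WP have W: "S \<subseteq> W" "W \<subseteq> U" "x \<notin> lin_span act W" by (simp_all add: P_def)
    have "lin_span act T \<subseteq> lin_span act U" by (rule span_least[OF U(4)])
    then have xU: "x \<in> lin_span act U" using insert.prems(2) by auto
    then have "W \<noteq> U" using W(3) by auto
    then obtain b where b: "b \<in> U" "b \<notin> W" using W(2) by auto
    have "x \<in> lin_span act (insert b W)"
    proof (rule ccontr)
      assume "x \<notin> lin_span act (insert b W)"
      then have "insert b W \<in> P" using W b(1) by (auto simp: P_def)
      then have "W = insert b W" using Wmax by (meson subset_insertI)
      then show False using b(2) by auto
    qed
    then have "b \<in> lin_span act (insert x W)" by (rule exchange[OF _ W(3)])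
    moreover let ?U = "insert x (U - {b})"
    have "insert x W \<subseteq> ?U" using W(2) b by auto
    then have "lin_span act (insert x W) \<subseteq> lin_span act ?U" by (rule span_mono)
    ultimately have bU: "b \<in> lin_span act ?U" by auto
    have "U \<subseteq> lin_span act ?U" using bU span_superset[of ?U] by auto
    then have "lin_span act U \<subseteq> lin_span act ?U" by (rule span_least)
    then have "T \<subseteq> lin_span act ?U" using U(4) by auto
    moreover have "card ?U = card T"
      using U(1,2) b(1) False by (metis DiffD1 card_Suc_Diff1 card_insert_disjoint finite_Diff)
    moreover have "insert x S \<subseteq> ?U" using W(1,2) b by auto
    moreover have "finite ?U" using U(1) by simp
    ultimately show ?thesis by (intro exI[of _ ?U]) simp
  qed
qed

lemma steinitz:
  assumes "finite T" "lin_indep act S" "S \<subseteq> lin_span act T"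
  shows "finite S \<and> card S \<le> card T"
proof -
  have *: "card S' \<le> card T" if S': "finite S'" "S' \<subseteq> S" for S'
  proof -
    have "lin_indep act S'" "S' \<subseteq> lin_span act T" using indep_mono assms S'(2) by auto
    from steinitz_aux[OF S'(1) assms(1) this] show ?thesis by (metis card_mono)
  qed
  have "finite S"
  proof (rule ccontr)
    assume "infinite S"
    then obtain S' where "S' \<subseteq> S" "finite S'" "card S' = Suc (card T)"
      using infinite_arbitrarily_large by blast
    with * show False by fastforce
  qed
  with * show ?thesis by blast
qed

lemma basis_exists:
  assumes "lin_subspace act V" shows "\<exists>B. is_basis act V B"
proof -
  let ?I = "{B. B \<subseteq> V \<and> lin_indep act B}"
  have "\<exists>M\<in>?I. \<forall>X\<in>?I. M \<subseteq> X \<longrightarrow> X = M"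
  proof (rule subset_Zorn_nonempty)
    have "{} \<in> ?I" by (simp add: lin_indep_def)
    then show "?I \<noteq> {}" by (rule ex_in_conv[THEN iffD1, OF exI])
  next
    fix C assume C: "C \<noteq> {}" "subset.chain ?I C"
    have sub: "C \<subseteq> ?I" using C(2) by (simp add: subset.chain_def)
    have "lin_indep act (\<Union>C)"
      unfolding lin_indep_def
    proof (intro allI impI, elim conjE)
      fix F c assume F: "finite F" "F \<subseteq> \<Union>C" "(\<Sum>b\<in>F. act (c b) b) = 0"
      obtain B where B: "B \<in> C" "F \<subseteq> B"
        using finite_subset_Union_chain[OF F(1,2) C(1)] C(2) by blast
      then have "lin_indep act B" using sub by auto
      with F B show "\<forall>b\<in>F. c b = 0" unfolding lin_indep_def by blast
    qed
    then show "\<Union>C \<in> ?I" using sub by auto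
  qed
  then obtain M where MI: "M \<in> ?I" and max: "\<forall>X\<in>?I. M \<subseteq> X \<longrightarrow> X = M" ..
  from MI have M: "M \<subseteq> V" "lin_indep act M" by simp_all
  have "V \<subseteq> lin_span act M"
  proof
    fix x assume x: "x \<in> V"
    show "x \<in> lin_span act M"
    proof (rule ccontr)
      assume nx: "x \<notin> lin_span act M"
      then have "insert x M \<in> ?I" using indep_insert[OF M(2)] x M(1) by simp
      then have "insert x M = M" using max by (meson subset_insertI)
      then show False using nx span_superset[of M] by auto
    qed
  qed
  then show ?thesis
    using M span_minimal[OF M(1) assms] unfolding is_basis_def by (intro exI[of _ M]) simp
qed

lemma basis_ordLeq:
  assumes "is_basis act V A" "is_basis act V B" shows "|A| \<le>o |B|"
proof (cases "finite B")
  case True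
  have "A \<subseteq> lin_span act B" using assms span_superset unfolding is_basis_def by blast
  with True have "finite A" "card A \<le> card B"
    using steinitz assms(1) unfolding is_basis_def by blast+
  with True show ?thesis by (meson card_of_ordLeq inj_on_iff_card_le)
next
  case False
  have "\<forall>b\<in>B. \<exists>F. finite F \<and> F \<subseteq> A \<and> b \<in> lin_span act F"
  proof
    fix b assume "b \<in> B"
    then have "b \<in> lin_span act A" using assms span_superset unfolding is_basis_def by blast
    then show "\<exists>F. finite F \<and> F \<subseteq> A \<and> b \<in> lin_span act F" unfolding lin_span_def by blast
  qed
  then obtain F where F: "\<And>b. b \<in> B \<Longrightarrow> finite (F b) \<and> F b \<subseteq> A \<and> b \<in> lin_span act (F b)"
    by metis
  have "A \<subseteq> (\<Union>b\<in>B. F b)"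
  proof (rule ccontr)
    assume "\<not> A \<subseteq> (\<Union>b\<in>B. F b)"
    then obtain a where a: "a \<in> A" "a \<notin> (\<Union>b\<in>B. F b)" by blast
    have "B \<subseteq> lin_span act (A - {a})"
    proof
      fix b assume b: "b \<in> B"
      then have "F b \<subseteq> A - {a}" using F a(2) by blast
      then show "b \<in> lin_span act (A - {a})" using span_mono F[OF b] by blast
    qed
    then have "lin_span act B \<subseteq> lin_span act (A - {a})" by (rule span_least)
    moreover have "a \<in> lin_span act B"
      using a(1) assms span_superset unfolding is_basis_def by blast
    ultimately show False using indep_notin_span a(1) assms(1) unfolding is_basis_def by blast
  qed
  then have "|A| \<le>o |\<Union>b\<in>B. F b|" by (rule card_of_mono1)
  moreover have "|\<Union>b\<in>B. F b| \<le>o |B|"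
  proof (rule card_of_UNION_ordLeq_infinite[OF False])
    show "|B| \<le>o |B|" by (rule card_of_mono1) simp
    show "\<forall>b\<in>B. |F b| \<le>o |B|"
      using F False by (meson card_of_Well_order card_of_ordLeq_infinite ordLeq_total)
  qed
  ultimately show ?thesis by (rule ordLeq_transitive)
qed

lemma dimension_eq:
  assumes "is_basis act V B" shows "|B| =o dimension act V"
proof -
  have "is_basis act V (SOME B. is_basis act V B)" using assms by (rule someI)
  then show ?thesis
    unfolding dimension_def using assms basis_ordLeq ordIso_iff_ordLeq by blast
qed

end

sublocale left_vector_space \<subseteq> skew_action scale "(*)"
  by unfold_locales
    (simp_all add: scale_left_distrib scale_right_distrib scale_scale scale_one)

sublocale right_vector_space \<subseteq> skew_action "\<lambda>a x. scale x a" "\<lambda>a b. b * a"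
  by unfold_locales
    (simp_all add: scale_left_distrib scale_right_distrib scale_scale scale_one)

lemma (in left_vector_space) subspace_UNIV: "lin_subspace scale UNIV"
  by (simp add: lin_subspace_def)

lemma right_vector_space_dual_scale: "right_vector_space dual_scale"
  by unfold_locales (auto simp: dual_scale_def fun_eq_iff algebra_simps)

lemma subspace_dual: "lin_subspace (\<lambda>a \<phi>. dual_scale \<phi> a) (dual scale)"
  by (auto simp: lin_subspace_def dual_def dual_scale_def algebra_simps)

end

theory Submission
  imports Defs
begin

text \<open>
  Let \<open>B\<close> be a basis of \<open>V\<close> and \<open>\<Phi>\<close> a basis of \<open>V\<^sup>*\<close>. Restriction to \<open>B\<close> identifies \<open>V\<^sup>*\<close> with the
  functions \<open>B \<rightarrow> K\<close>, so \<open>V\<^sup>*\<close> has \<open>Card(K)\<close> to the power \<open>dim V\<close> elements. On the other hand, a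
  vector space with an infinite basis \<open>\<Phi>\<close> such that \<open>Card(K) \<le> Card(\<Phi>)\<close> has exactly \<open>Card(\<Phi>)\<close>
  elements. So everything rests on \<open>\<Phi>\<close> being infinite with \<open>Card(K) \<le> Card(\<Phi>)\<close>.

  The usual argument with the sequences \<open>(1, a, a\<^sup>2, \<dots>)\<close> for \<open>a \<in> K\<close> fails here, since over a
  noncommutative \<open>K\<close> such sequences may be dependent for distinct \<open>a\<close>. Instead, two facts about
  \<open>V\<close> are played against each other. Since \<open>V\<close> is infinite-dimensional, finitely many functionals
  always have a common zero \<open>x \<noteq> 0\<close> (\<open>common_zero\<close>). Conversely, fewer than \<open>Card(K)\<close> nonzero
  vectors never exhaust the functionals: some functional vanishes on none of them
  (\<open>functional_avoiding\<close>). Choose for each finite \<open>F \<subseteq> \<Phi>\<close> a common zero \<open>x\<^sub>F \<noteq> 0\<close> of \<open>F\<close>. Every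
  functional is in the span of some such \<open>F\<close> and hence vanishes at \<open>x\<^sub>F\<close>; so there must be at least
  \<open>Card(K)\<close> finite subsets of \<open>\<Phi>\<close>. As \<open>Card(K) \<ge> 2\<close>, the same argument with the single vector
  \<open>x\<^sub>\<Phi>\<close> excludes that \<open>\<Phi>\<close> is finite. An infinite \<open>\<Phi>\<close> has only \<open>Card(\<Phi>)\<close> finite subsets.
\<close>

section \<open>Cardinalities of finite lists and of spans\<close>

lemma card_of_lists_ordLeq:
  assumes "infinite A" shows "|lists A| \<le>o |A|"
proof -
  have len: "|{xs \<in> lists A. length xs = n}| \<le>o |A|" for n
  proof (induction n)
    case 0
    obtain a where "a \<in> A" using assms by fastforce
    have "{xs \<in> lists A. length xs = 0} \<subseteq> (\<lambda>_. []) ` A" using \<open>a \<in> A\<close> by auto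
    then show ?case by (rule surj_imp_ordLeq)
  next
    case (Suc n)
    have "{xs \<in> lists A. length xs = Suc n}
        \<subseteq> (\<lambda>(x, xs). x # xs) ` (A \<times> {xs \<in> lists A. length xs = n})"
      by (auto simp: length_Suc_conv image_iff)
    then have "|{xs \<in> lists A. length xs = Suc n}| \<le>o |A \<times> {xs \<in> lists A. length xs = n}|"
      by (rule surj_imp_ordLeq)
    also have "|A \<times> {xs \<in> lists A. length xs = n}| \<le>o |A|"
      by (rule card_of_Times_ordLeq_infinite_Field[OF _ _ Suc card_of_Card_order])
        (simp_all add: Field_card_of assms card_of_mono1)
    finally show ?case .
  qed
  have "lists A = (\<Union>n. {xs \<in> lists A. length xs = n})" by blast
  moreover have "|\<Union>n\<in>(UNIV :: nat set). {xs \<in> lists A. length xs = n}| \<le>o |A|"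
    using assms len by (intro card_of_UNION_ordLeq_infinite) (auto simp: infinite_iff_card_of_nat)
  ultimately show ?thesis by simp
qed

lemma card_of_finite_subsets_ordLeq:
  assumes "infinite A" shows "|{F. finite F \<and> F \<subseteq> A}| \<le>o |A|"
proof -
  have "{F. finite F \<and> F \<subseteq> A} \<subseteq> set ` lists A"
    using finite_list by (auto simp: image_iff lists_eq_set)
  then have "|{F. finite F \<and> F \<subseteq> A}| \<le>o |lists A|" by (rule surj_imp_ordLeq)
  then show ?thesis using card_of_lists_ordLeq[OF assms] by (rule ordLeq_transitive)
qed

lemma (in skew_action) span_finite_subset:
  assumes "x \<in> lin_span act B"
  obtains F where "finite F" "F \<subseteq> B" "x \<in> lin_span act F"
  using assms unfolding lin_span_def by blast

lemma (in skew_action) card_of_span_ordLeq: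
  assumes "infinite B" "|UNIV :: 'k set| \<le>o |B|" shows "|lin_span act B| \<le>o |B|"
proof -
  let ?P = "B \<times> (UNIV :: 'k set)"
  have "lin_span act B \<subseteq> (\<lambda>ps. \<Sum>(b, a)\<leftarrow>ps. act a b) ` lists ?P"
  proof
    fix x assume "x \<in> lin_span act B"
    then obtain F c where F: "finite F" "F \<subseteq> B" "x = (\<Sum>b\<in>F. act (c b) b)"
      unfolding lin_span_def by blast
    obtain bs where bs: "set bs = F" "distinct bs" using F(1) finite_distinct_list by blast
    have "x = (\<Sum>(b, a)\<leftarrow>map (\<lambda>b. (b, c b)) bs. act a b)"
      using bs F(3) by (simp add: o_def sum_list_distinct_conv_sum_set)
    moreover have "map (\<lambda>b. (b, c b)) bs \<in> lists ?P" using bs F(2) by (auto simp: lists_eq_set)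
    ultimately show "x \<in> (\<lambda>ps. \<Sum>(b, a)\<leftarrow>ps. act a b) ` lists ?P" by blast
  qed
  then have "|lin_span act B| \<le>o |lists ?P|" by (rule surj_imp_ordLeq)
  also have "|lists ?P| \<le>o |?P|"
    using assms(1) by (intro card_of_lists_ordLeq) (auto simp: finite_cartesian_product_iff)
  also have "|?P| \<le>o |B|"
    by (rule card_of_Times_ordLeq_infinite_Field[OF _ _ assms(2) card_of_Card_order])
      (simp_all add: Field_card_of assms(1) card_of_mono1)
  finally show ?thesis .
qed

section \<open>Common zeros of finitely many functionals\<close>

lemma dual_add: "\<phi> \<in> dual scale \<Longrightarrow> \<phi> (x + y) = \<phi> x + \<phi> y"
  and dual_act: "\<phi> \<in> dual scale \<Longrightarrow> \<phi> (scale a x) = a * \<phi> x"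
  by (simp_all add: dual_def)

lemma dual_zero: "\<phi> \<in> dual scale \<Longrightarrow> \<phi> 0 = 0"
  using dual_add[of \<phi> scale 0 0] by simp

lemma dual_diff: "\<phi> \<in> dual scale \<Longrightarrow> \<phi> (x - y) = \<phi> x - \<phi> y"
  using dual_add[of \<phi> scale "x - y" y] by (simp add: algebra_simps)

lemma dual_sum:
  assumes "\<phi> \<in> dual scale"
  shows "\<phi> (\<Sum>b\<in>F. scale (c b) b) = (\<Sum>b\<in>F. c b * \<phi> b)"
  by (induction F rule: infinite_finite_induct)
    (simp_all add: dual_add[OF assms] dual_act[OF assms] dual_zero[OF assms])

lemma span_dual_zero:
  fixes \<phi> :: "'v \<Rightarrow> 'k::division_ring"
  assumes "\<phi> \<in> lin_span (\<lambda>a \<phi>. dual_scale \<phi> a) F" "\<forall>\<psi>\<in>F. \<psi> x = 0"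
  shows "\<phi> x = 0"
proof -
  interpret D: right_vector_space "dual_scale :: ('v \<Rightarrow> 'k) \<Rightarrow> 'k \<Rightarrow> 'v \<Rightarrow> 'k"
    by (rule right_vector_space_dual_scale)
  have "lin_subspace (\<lambda>a \<phi>. dual_scale \<phi> a) {\<phi> :: 'v \<Rightarrow> 'k. \<phi> x = 0}"
    by (auto simp: lin_subspace_def dual_scale_def)
  with assms D.span_minimal[of F "{\<phi>. \<phi> x = 0}"] show ?thesis by blast
qed

context left_vector_space
begin

text \<open>
  Passing to the kernel of one more functional \<open>\<phi>\<close> costs at most one dimension: if \<open>\<phi> a \<noteq> 0\<close>, then
  every \<open>x\<close> differs by a multiple of \<open>a\<close> from a zero of \<open>\<phi>\<close>.
\<close>
lemma common_kernel_not_finitely_spanned: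
  assumes inf: "\<And>T. finite T \<Longrightarrow> lin_span scale T \<noteq> UNIV"
    and "finite F" "F \<subseteq> dual scale" "finite T"
  shows "\<not> {x. \<forall>\<phi>\<in>F. \<phi> x = 0} \<subseteq> lin_span scale T"
  using assms(2-4)
proof (induction F arbitrary: T)
  case empty
  then show ?case using inf by auto
next
  case (insert \<phi> F)
  let ?U = "{x. \<forall>\<psi>\<in>F. \<psi> x = 0}"
  have \<phi>: "\<phi> \<in> dual scale" and F: "F \<subseteq> dual scale" using insert.prems by auto
  show ?case
  proof
    assume sub: "{x. \<forall>\<psi>\<in>insert \<phi> F. \<psi> x = 0} \<subseteq> lin_span scale T"
    show False
    proof (cases "\<exists>a\<in>?U. \<phi> a \<noteq> 0")
      case False
      with sub have "?U \<subseteq> lin_span scale T" by auto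
      with insert.IH[OF F insert.prems(2)] show False by blast
    next
      case True
      then obtain a where a: "a \<in> ?U" "\<phi> a \<noteq> 0" by blast
      have "?U \<subseteq> lin_span scale (insert a T)"
      proof
        fix x assume x: "x \<in> ?U"
        let ?k = "\<phi> x * inverse (\<phi> a)"
        have "\<psi> (x - scale ?k a) = 0" if "\<psi> \<in> insert \<phi> F" for \<psi>
        proof (cases "\<psi> = \<phi>")
          case True
          then show ?thesis using a(2) by (simp add: dual_diff[OF \<phi>] dual_act[OF \<phi>] mult.assoc)
        next
          case False
          with that have "\<psi> \<in> F" by blast
          with F have "\<psi> \<in> dual scale" by blast
          then show ?thesis
            using \<open>\<psi> \<in> F\<close> x a(1) by (auto simp: dual_diff[of \<psi> scale] dual_act[of \<psi> scale])
        qed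
        then have "x - scale ?k a \<in> lin_span scale T" using sub by blast
        then have "x - scale ?k a \<in> lin_span scale (insert a T)"
          using span_mono[of T "insert a T"] by blast
        moreover have "scale ?k a \<in> lin_span scale (insert a T)"
          using span_superset[of "insert a T"] span_subspace[of "insert a T"]
          unfolding lin_subspace_def by blast
        ultimately have "(x - scale ?k a) + scale ?k a \<in> lin_span scale (insert a T)"
          by (rule span_add)
        then show "x \<in> lin_span scale (insert a T)" by simp
      qed
      with insert.IH[OF F, of "insert a T"] insert.prems(2) show False by blast
    qed
  qed
qed

text \<open>Were \<open>0\<close> the only common zero, the common kernel would be spanned by the empty set.\<close>
lemma common_zero:
  assumes "is_basis scale UNIV B" "infinite B" "finite F" "F \<subseteq> dual scale"
  obtains x where "x \<noteq> 0" "\<forall>\<phi>\<in>F. \<phi> x = 0"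
proof -
  have "lin_span scale T \<noteq> UNIV" if "finite T" for T
    using steinitz[OF that, of B] assms(1,2) unfolding is_basis_def by auto
  then have "\<not> {x. \<forall>\<phi>\<in>F. \<phi> x = 0} \<subseteq> lin_span scale {}"
    using common_kernel_not_finitely_spanned assms(3,4) by blast
  moreover have "0 \<in> lin_span scale {}" using span_subspace unfolding lin_subspace_def by blast
  ultimately obtain x where "\<forall>\<phi>\<in>F. \<phi> x = 0" "x \<noteq> 0" by blast
  then show ?thesis using that by blast
qed

end

section \<open>Functionals with prescribed values on a basis\<close>

locale left_vector_space_basis = left_vector_space scale
  for scale :: "'k::division_ring \<Rightarrow> 'v::ab_group_add \<Rightarrow> 'v" +
  fixes B :: "'v set"
  assumes basis: "is_basis scale UNIV B"
begin

definition coords :: "'v \<Rightarrow> ('v \<Rightarrow> 'k) \<Rightarrow> bool" where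
  "coords x c \<longleftrightarrow> finite {b. c b \<noteq> 0} \<and> {b. c b \<noteq> 0} \<subseteq> B \<and> x = (\<Sum>b | c b \<noteq> 0. scale (c b) b)"

definition coord :: "'v \<Rightarrow> 'v \<Rightarrow> 'k" where
  "coord x = (SOME c. coords x c)"

lemma coordsI:
  assumes "finite F" "F \<subseteq> B" "\<And>b. b \<notin> F \<Longrightarrow> c b = 0"
  shows "coords (\<Sum>b\<in>F. scale (c b) b) c"
proof -
  have sub: "{b. c b \<noteq> 0} \<subseteq> F" using assms(3) by blast
  moreover have "(\<Sum>b\<in>F. scale (c b) b) = (\<Sum>b | c b \<noteq> 0. scale (c b) b)"
    by (rule sum.mono_neutral_right) (use assms(1) sub in auto)
  ultimately show ?thesis unfolding coords_def using assms(1,2) finite_subset by blast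
qed

lemma coords_coord: "coords x (coord x)"
proof -
  have "x \<in> lin_span scale B" using basis unfolding is_basis_def by blast
  then obtain F c where F: "finite F" "F \<subseteq> B" "x = (\<Sum>b\<in>F. scale (c b) b)"
    unfolding lin_span_def by blast
  let ?c = "\<lambda>b. if b \<in> F then c b else 0"
  have "x = (\<Sum>b\<in>F. scale (?c b) b)" unfolding F(3) by (rule sum.cong) auto
  then have "coords x ?c" using coordsI[OF F(1,2), of ?c] by simp
  then show ?thesis unfolding coord_def by (rule someI[of "coords x"])
qed

lemma finite_support: "finite {b. coord x b \<noteq> 0}"
  and support_subset: "{b. coord x b \<noteq> 0} \<subseteq> B"
  and coord_sum: "(\<Sum>b | coord x b \<noteq> 0. scale (coord x b) b) = x"
  using coords_coord[of x] unfolding coords_def by auto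

lemma coords_unique:
  assumes "coords x c" "coords x d" shows "c = d"
proof
  fix b
  let ?F = "{b. c b \<noteq> 0} \<union> {b. d b \<noteq> 0}"
  have fin: "finite ?F" "?F \<subseteq> B" using assms unfolding coords_def by auto
  have "x = (\<Sum>b\<in>?F. scale (c b) b)"
    using assms(1) fin unfolding coords_def by (auto intro!: sum.mono_neutral_left)
  moreover have "x = (\<Sum>b\<in>?F. scale (d b) b)"
    using assms(2) fin unfolding coords_def by (auto intro!: sum.mono_neutral_left)
  moreover have "scale (c b - d b) b = scale (c b) b - scale (d b) b" for b
    using scale_left_distrib[of "c b - d b" "d b" b] by simp
  ultimately have "(\<Sum>b\<in>?F. scale (c b - d b) b) = 0" by (simp add: sum_subtractf)
  moreover have "lin_indep scale B" using basis by (simp add: is_basis_def)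
  ultimately have eq: "\<forall>b\<in>?F. c b - d b = 0"
    using fin unfolding lin_indep_def
    by (elim allE[of _ ?F] allE[of _ "\<lambda>b. c b - d b"]) (rule mp, assumption, intro conjI)
  show "c b = d b"
  proof (cases "b \<in> ?F")
    case True
    with eq have "c b - d b = 0" by (rule bspec)
    then show ?thesis by (rule eq_iff_diff_eq_0[THEN iffD2])
  next
    case False
    then show ?thesis by simp
  qed
qed

lemma coord_eqI: "coords x c \<Longrightarrow> coord x = c"
  using coords_coord coords_unique by blast

lemma coord_add: "coord (x + y) b = coord x b + coord y b"
proof -
  let ?F = "{b. coord x b \<noteq> 0} \<union> {b. coord y b \<noteq> 0}"
  have fin: "finite ?F" "?F \<subseteq> B" using finite_support support_subset by auto
  have x: "(\<Sum>b\<in>?F. scale (coord x b) b) = (\<Sum>b | coord x b \<noteq> 0. scale (coord x b) b)"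
    by (rule sum.mono_neutral_right) (use fin in auto)
  have y: "(\<Sum>b\<in>?F. scale (coord y b) b) = (\<Sum>b | coord y b \<noteq> 0. scale (coord y b) b)"
    by (rule sum.mono_neutral_right) (use fin in auto)
  have "(\<Sum>b\<in>?F. scale (coord x b + coord y b) b) = x + y"
    by (simp only: scale_left_distrib sum.distrib x y coord_sum)
  then have "coords (x + y) (\<lambda>b. coord x b + coord y b)"
    using coordsI[OF fin, of "\<lambda>b. coord x b + coord y b"] by auto
  then show ?thesis by (simp add: coord_eqI)
qed

lemma coord_scale: "coord (scale a x) b = a * coord x b"
proof -
  let ?F = "{b. coord x b \<noteq> 0}"
  have "(\<Sum>b\<in>?F. scale (a * coord x b) b) = scale a (\<Sum>b\<in>?F. scale (coord x b) b)"
    by (simp add: act_sum scale_scale)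
  then have "(\<Sum>b\<in>?F. scale (a * coord x b) b) = scale a x"
    by (simp only: coord_sum)
  then have "coords (scale a x) (\<lambda>b. a * coord x b)"
    using coordsI[OF finite_support support_subset, of x "\<lambda>b. a * coord x b"] by auto
  then show ?thesis by (simp add: coord_eqI)
qed

lemma coord_basis: "b \<in> B \<Longrightarrow> coord b = (\<lambda>d. if d = b then 1 else 0)"
  using coordsI[of "{b}" "\<lambda>d. if d = b then 1 else 0"] by (intro coord_eqI) (simp add: scale_one)

definition extend :: "('v \<Rightarrow> 'k) \<Rightarrow> 'v \<Rightarrow> 'k" where
  "extend g x = (\<Sum>b | coord x b \<noteq> 0. coord x b * g b)"

lemma extend_superset:
  "finite F \<Longrightarrow> {b. coord x b \<noteq> 0} \<subseteq> F \<Longrightarrow> extend g x = (\<Sum>b\<in>F. coord x b * g b)"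
  unfolding extend_def by (rule sum.mono_neutral_left) auto

lemma extend_in_dual: "extend g \<in> dual scale"
proof -
  have "extend g (x + y) = extend g x + extend g y" for x y
  proof -
    let ?F = "{b. coord x b \<noteq> 0} \<union> {b. coord y b \<noteq> 0}"
    have fin: "finite ?F" using finite_support by auto
    moreover have "{b. coord (x + y) b \<noteq> 0} \<subseteq> ?F" by (auto simp: coord_add)
    ultimately show ?thesis
      using extend_superset[OF fin, of x g] extend_superset[OF fin, of y g]
        extend_superset[OF fin, of "x + y" g]
      by (simp add: coord_add distrib_right sum.distrib)
  qed
  moreover have "extend g (scale a x) = a * extend g x" for a x
  proof -
    have "{b. coord (scale a x) b \<noteq> 0} \<subseteq> {b. coord x b \<noteq> 0}" by (auto simp: coord_scale)
    from extend_superset[OF finite_support this, of g] show ?thesis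
      by (simp add: coord_scale extend_def sum_distrib_left mult.assoc)
  qed
  ultimately show ?thesis by (simp add: dual_def)
qed

lemma extend_basis: "b \<in> B \<Longrightarrow> extend g b = g b"
  by (simp add: extend_superset[of "{b}"] coord_basis)

lemma dual_eqI:
  assumes "\<phi> \<in> dual scale" "\<psi> \<in> dual scale" "\<And>b. b \<in> B \<Longrightarrow> \<phi> b = \<psi> b"
  shows "\<phi> = \<psi>"
proof
  fix x
  have "(\<Sum>b | coord x b \<noteq> 0. coord x b * \<phi> b) = (\<Sum>b | coord x b \<noteq> 0. coord x b * \<psi> b)"
    by (rule sum.cong) (use support_subset[of x] assms(3) in auto)
  then show "\<phi> x = \<psi> x"
    using dual_sum[OF assms(1), of "coord x"] dual_sum[OF assms(2), of "coord x"]
    by (metis coord_sum)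
qed

lemma card_of_dual: "|dual scale| =o |Func B (UNIV :: 'k set)|"
proof -
  let ?h = "\<lambda>\<phi> b. if b \<in> B then \<phi> b else undefined"
  have "bij_betw ?h (dual scale) (Func B UNIV)"
    unfolding bij_betw_def
  proof
    show "inj_on ?h (dual scale)"
    proof (rule inj_onI)
      fix \<phi> \<psi> assume "\<phi> \<in> dual scale" "\<psi> \<in> dual scale" and eq: "?h \<phi> = ?h \<psi>"
      moreover have "\<phi> b = \<psi> b" if "b \<in> B" for b using fun_cong[OF eq, of b] that by simp
      ultimately show "\<phi> = \<psi>" by (intro dual_eqI)
    qed
    show "?h ` dual scale = Func B UNIV"
    proof
      show "?h ` dual scale \<subseteq> Func B UNIV" by (auto simp: Func_def)
      show "Func B UNIV \<subseteq> ?h ` dual scale"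
      proof
        fix g :: "'v \<Rightarrow> 'k" assume "g \<in> Func B UNIV"
        then have "g = ?h (extend g)" by (auto simp: Func_def extend_basis fun_eq_iff)
        then show "g \<in> ?h ` dual scale" using extend_in_dual by blast
      qed
    qed
  qed
  then show ?thesis using card_of_ordIso by blast
qed

section \<open>A functional vanishing on none of few vectors\<close>

text \<open>
  Well-order the basis and choose the values of the functional by recursion. Once the values
  below \<open>b\<close> are chosen, a vector whose last nonzero coordinate is at \<open>b\<close> excludes exactly one
  value at \<open>b\<close>; there are fewer than \<open>Card(K)\<close> such vectors, so an admissible value remains.
\<close>
lemma functional_avoiding:
  assumes small: "|X| <o |UNIV :: 'k set|" and "0 \<notin> X"
  obtains \<phi> where "\<phi> \<in> dual scale" "\<forall>x\<in>X. \<phi> x \<noteq> 0"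
proof -
  obtain r :: "'v rel" where r: "Well_order r" "Field r = UNIV"
    using well_ordering by (elim exE conjE)
  let ?R = "r - Id"
  have wf: "wf ?R" using r(1) by (simp add: well_order_on_def)
  have lin: "Linear_order r" using r(1) by (simp add: well_order_on_def)
  then have "refl_on UNIV r" "total_on UNIV r" and trans: "trans r"
    using r(2) by (simp_all add: order_on_defs)
  then have tot: "(a, b) \<in> r \<or> (b, a) \<in> r" for a b
    by (cases "a = b") (auto simp: refl_on_def total_on_def)
  have max: "\<exists>m\<in>S. \<forall>s\<in>S. (s, m) \<in> r" if "finite S" "S \<noteq> {}" for S
    using that
  proof (induction S rule: finite_ne_induct)
    case (singleton a)
    then show ?case using tot by blast
  next
    case (insert a S)
    then obtain m where m: "m \<in> S" "\<forall>s\<in>S. (s, m) \<in> r" by blast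
    show ?case
    proof (cases "(a, m) \<in> r")
      case True
      with m show ?thesis by blast
    next
      case False
      then have "(m, a) \<in> r" "(a, a) \<in> r" using tot by blast+
      with m trans show ?thesis by (blast dest: transD)
    qed
  qed
  define supp where "supp x = {b. coord x b \<noteq> 0}" for x
  have "\<exists>m\<in>supp x. \<forall>s\<in>supp x. (s, m) \<in> r" if "x \<in> X" for x
  proof (rule max)
    show "finite (supp x)" by (simp add: supp_def finite_support)
    show "supp x \<noteq> {}" using coord_sum[of x] that assms(2) unfolding supp_def by fastforce
  qed
  then obtain lead where lead: "\<And>x. x \<in> X \<Longrightarrow> lead x \<in> supp x \<and> (\<forall>s\<in>supp x. (s, lead x) \<in> r)"
    by metis
  define low where "low f x = (\<Sum>d\<in>supp x - {lead x}. coord x d * f d)" for f x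
  have low_cong: "low f x = low g x"
    if "\<And>z. (z, lead x) \<in> ?R \<Longrightarrow> f z = g z" "x \<in> X" for f g x
    unfolding low_def by (rule sum.cong) (use lead[OF that(2)] that(1) in auto)
  let ?P = "\<lambda>f b k. \<forall>x\<in>X. lead x = b \<longrightarrow> low f x + coord x b * k \<noteq> 0"
  have "\<exists>f. \<forall>b. ?P f b (f b)"
  proof (rule dependent_wf_choice[OF wf])
    fix f g :: "'v \<Rightarrow> 'k" and b k assume "\<And>z. (z, b) \<in> ?R \<Longrightarrow> f z = g z"
    then show "?P f b k = ?P g b k" using low_cong[of _ f g] by auto
  next
    fix b and f :: "'v \<Rightarrow> 'k"
    let ?excluded = "\<lambda>x. inverse (coord x b) * - low f x"
    have "|?excluded ` X| <o |UNIV :: 'k set|"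
      using card_of_image small ordLeq_ordLess_trans by blast
    then have "?excluded ` X \<noteq> UNIV" using ordLess_irreflexive by force
    then obtain k where k: "k \<notin> ?excluded ` X" by blast
    have "low f x + coord x b * k \<noteq> 0" if "x \<in> X" "lead x = b" for x
    proof
      assume "low f x + coord x b * k = 0"
      then have "coord x b * k = - low f x" by (simp add: eq_neg_iff_add_eq_0 add.commute)
      then have "inverse (coord x b) * (coord x b * k) = ?excluded x" by simp
      moreover have "coord x b \<noteq> 0" using lead[OF that(1)] that(2) by (simp add: supp_def)
      ultimately have "k = ?excluded x" by (simp flip: mult.assoc)
      with k that(1) show False by blast
    qed
    then show "\<exists>k. ?P f b k" by blast
  qed
  then obtain f where f: "\<And>b. ?P f b (f b)" by blast
  have "extend f x \<noteq> 0" if "x \<in> X" for x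
  proof -
    have "extend f x = coord x (lead x) * f (lead x) + low f x"
      unfolding extend_def low_def supp_def[symmetric]
      by (rule sum.remove) (use lead[OF that] finite_support in \<open>auto simp: supp_def\<close>)
    then show ?thesis using f[of "lead x"] that by (simp add: add.commute)
  qed
  then show thesis using that extend_in_dual by blast
qed

section \<open>The dimension of the dual\<close>

text \<open>
  Every functional \<open>\<phi>\<close> is a combination of a finite \<open>F \<subseteq> \<Phi>\<close> and so vanishes at the common zero
  chosen for \<open>F\<close>. By \<open>functional_avoiding\<close>, the set of these zeros then has at least \<open>Card(K)\<close>
  elements.
\<close>
lemma dual_basis_large:
  assumes "infinite B" and \<Phi>: "is_basis (\<lambda>a \<phi>. dual_scale \<phi> a) (dual scale) \<Phi>"
  shows "infinite \<Phi>" "|UNIV :: 'k set| \<le>o |\<Phi>|"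
proof -
  interpret D: right_vector_space "dual_scale :: ('v \<Rightarrow> 'k) \<Rightarrow> 'k \<Rightarrow> 'v \<Rightarrow> 'k"
    by (rule right_vector_space_dual_scale)
  have sub: "\<Phi> \<subseteq> dual scale" and span: "lin_span (\<lambda>a \<phi>. dual_scale \<phi> a) \<Phi> = dual scale"
    using \<Phi> D.span_superset unfolding is_basis_def by blast+
  show inf: "infinite \<Phi>"
  proof
    assume "finite \<Phi>"
    then obtain x where x: "x \<noteq> 0" "\<forall>\<psi>\<in>\<Phi>. \<psi> x = 0"
      using common_zero[OF basis assms(1) _ sub] by blast
    have "|{x}| <o |UNIV :: 'k set|"
    proof -
      have "f ` {x} \<noteq> (UNIV :: 'k set)" for f
      proof
        assume "f ` {x} = UNIV"
        then have "0 \<in> f ` {x}" "1 \<in> f ` {x}" by simp_all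
        then show False by simp
      qed
      then show ?thesis by (intro card_of_ordLess2[THEN iffD1]) auto
    qed
    then obtain \<phi> where "\<phi> \<in> dual scale" "\<phi> x \<noteq> 0"
      using functional_avoiding[of "{x}"] x(1) by auto
    then show False using span_dual_zero[OF _ x(2)] span by blast
  qed
  let ?\<F> = "{F. finite F \<and> F \<subseteq> \<Phi>}"
  have "\<exists>x. x \<noteq> 0 \<and> (\<forall>\<psi>\<in>F. \<psi> x = 0)" if "F \<in> ?\<F>" for F
  proof -
    from that sub have "finite F" "F \<subseteq> dual scale" by auto
    then obtain x where "x \<noteq> 0" "\<forall>\<psi>\<in>F. \<psi> x = 0" by (rule common_zero[OF basis assms(1)])
    then show ?thesis by blast
  qed
  then have "\<forall>F\<in>?\<F>. \<exists>x. x \<noteq> 0 \<and> (\<forall>\<psi>\<in>F. \<psi> x = 0)" by blast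
  then obtain z where z: "\<forall>F\<in>?\<F>. z F \<noteq> 0 \<and> (\<forall>\<psi>\<in>F. \<psi> (z F) = 0)"
    by (rule bchoice[THEN exE])
  have "\<not> |z ` ?\<F>| <o |UNIV :: 'k set|"
  proof
    assume "|z ` ?\<F>| <o |UNIV :: 'k set|"
    moreover have "0 \<notin> z ` ?\<F>" using z by (metis (no_types, lifting) imageE)
    ultimately obtain \<phi> where \<phi>: "\<phi> \<in> dual scale" "\<forall>x\<in>z ` ?\<F>. \<phi> x \<noteq> 0"
      by (rule functional_avoiding)
    from \<phi>(1) have "\<phi> \<in> lin_span (\<lambda>a \<phi>. dual_scale \<phi> a) \<Phi>" by (simp only: span)
    then obtain F where F: "finite F" "F \<subseteq> \<Phi>" "\<phi> \<in> lin_span (\<lambda>a \<phi>. dual_scale \<phi> a) F"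
      by (rule D.span_finite_subset)
    then have F\<F>: "F \<in> ?\<F>" by simp
    with z have "\<forall>\<psi>\<in>F. \<psi> (z F) = 0" by blast
    with F(3) have "\<phi> (z F) = 0" by (rule span_dual_zero)
    with \<phi>(2) F\<F> show False by blast
  qed
  then have "|UNIV :: 'k set| \<le>o |z ` ?\<F>|"
    by (simp add: not_ordLess_iff_ordLeq card_of_Well_order)
  also have "|z ` ?\<F>| \<le>o |?\<F>|" by (rule card_of_image)
  also have "|?\<F>| \<le>o |\<Phi>|" by (rule card_of_finite_subsets_ordLeq[OF inf])
  finally show "|UNIV :: 'k set| \<le>o |\<Phi>|" .
qed

lemma dimension_dual:
  assumes "infinite B"
  shows "dimension (\<lambda>a \<phi>. dual_scale \<phi> a) (dual scale) =o |Func B (UNIV :: 'k set)|"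
proof -
  interpret D: right_vector_space "dual_scale :: ('v \<Rightarrow> 'k) \<Rightarrow> 'k \<Rightarrow> 'v \<Rightarrow> 'k"
    by (rule right_vector_space_dual_scale)
  obtain \<Phi> where \<Phi>: "is_basis (\<lambda>a \<phi>. dual_scale \<phi> a) (dual scale) \<Phi>"
    using D.basis_exists[OF subspace_dual] by blast
  have "|dual scale| \<le>o |\<Phi>|"
    using D.card_of_span_ordLeq[OF dual_basis_large[OF assms \<Phi>]] \<Phi> by (simp add: is_basis_def)
  moreover have "|\<Phi>| \<le>o |dual scale|"
    using \<Phi> D.span_superset[of \<Phi>] by (intro card_of_mono1) (simp add: is_basis_def)
  ultimately have "|\<Phi>| =o |dual scale|" by (simp add: ordIso_iff_ordLeq)
  with D.dimension_eq[OF \<Phi>] card_of_dual show ?thesis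
    by (meson ordIso_symmetric ordIso_transitive)
qed

end

text \<open>Cantor's theorem, with subsets encoded by \<open>0\<close>-\<open>1\<close>-valued functions.\<close>
lemma card_of_ordLess_Func: "|A| <o |Func A (UNIV :: 'k::zero_neq_one set)|"
proof -
  let ?h = "\<lambda>S a. if a \<in> A then (if a \<in> S then 1 else 0) else undefined :: 'k"
  have "inj_on ?h (Pow A)"
  proof (rule inj_onI)
    fix S T assume ST: "S \<in> Pow A" "T \<in> Pow A" and eq: "?h S = ?h T"
    have "a \<in> S \<longleftrightarrow> a \<in> T" if "a \<in> A" for a
      using fun_cong[OF eq, of a] that by (auto split: if_splits)
    with ST show "S = T" by blast
  qed
  moreover have "?h ` Pow A \<subseteq> Func A UNIV" by (auto simp: Func_def)
  ultimately have "|Pow A| \<le>o |Func A (UNIV :: 'k set)|" using card_of_ordLeq by blast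
  with card_of_Pow show ?thesis by (rule ordLess_ordLeq_trans)
qed

theorem mainTheorem3:
  fixes scale :: "'k::division_ring \<Rightarrow> 'v::ab_group_add \<Rightarrow> 'v"
  assumes "left_vector_space scale"
    and "cinfinite (dimension scale UNIV)"
  shows "dimension (\<lambda>a \<phi>. dual_scale \<phi> a) (dual scale)
           =o |UNIV :: 'k set| ^c dimension scale UNIV
       \<and> \<not> dimension (\<lambda>a \<phi>. dual_scale \<phi> a) (dual scale) =o dimension scale UNIV"
proof -
  interpret left_vector_space scale by fact
  define B where "B = (SOME B. is_basis scale UNIV B)"
  have dim: "dimension scale UNIV = |B|" by (simp add: dimension_def B_def)
  have "is_basis scale UNIV B"
    unfolding B_def by (rule someI_ex) (rule basis_exists[OF subspace_UNIV])
  then interpret left_vector_space_basis scale B by unfold_locales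
  have "infinite B" using assms(2) by (simp add: dim cinfinite_def Field_card_of)
  then have eq: "dimension (\<lambda>a \<phi>. dual_scale \<phi> a) (dual scale) =o |Func B (UNIV :: 'k set)|"
    by (rule dimension_dual)
  moreover have "\<not> dimension (\<lambda>a \<phi>. dual_scale \<phi> a) (dual scale) =o |B|"
    using not_ordLess_ordIso[OF card_of_ordLess_Func[of B]] eq
    by (meson ordIso_symmetric ordIso_transitive)
  ultimately show ?thesis by (simp add: dim cexp_def Field_card_of)
qed

end
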